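(* Let $T_n:\mathbb{C}\times S^1\to\mathbb{C}$, $n\ge 1$, be maps such that, writing $T_{n,\theta}(z):=T_n(z,e^{i\theta})$, the map $T_{n,\theta}-\mathrm{Id}:\mathbb{C}\to\mathbb{C}$ has Lipschitz constant $\mathrm{Lip}(T_{n,\theta}-\mathrm{Id})<4^{-n}$ for all $n$ and all $\theta$. Then $(T_n)$ is an undercooking of the plane: there is a constant $C>0$ independent of $n$ such that $\mathrm{Fav}_{T_n}(\mathcal{K}_n)\ge C\frac{\log n}{n}$ for all $n\ge 2$.
   Context: Middle-half Cantor set: $\mathcal{C}_0=[0,1]$ and $\mathcal{C}_{n+1}$ is obtained from $\mathcal{C}_n$ by replacing each of its intervals by the first and last quarters of that interval. Thus $\mathcal{C}_n$ is a union of $2^n$ intervals of length $4^{-n}$ and $\mathcal{K}_n:=\mathcal{C}_n\times\mathcal{C}_n\subset\mathbb{C}$ is a union of $4^n$ squares of side $4^{-n}$. $\mathrm{Proj}_\theta$ is orthogonal projection onto the line through the origin in direction $e^{i\theta}$, $|\cdot|$ is one-dimensional Lebesgue measure. For $T:\mathbb{C}\times S^1\to\mathbb{C}$, $T_\theta(z):=T(z,e^{i\theta})$ and $\mathrm{Fav}_T(E):=\frac{1}{2\pi}\int_0^{2\pi}|\mathrm{Proj}_\theta(T_\theta(E))|\,d\theta$. *)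

theory Defs
  imports "HOL-Analysis.Analysis"
begin

fun cantor_intervals :: "nat \<Rightarrow> (real \<times> real) set" where
  "cantor_intervals 0 = {(0, 1)}"
| "cantor_intervals (Suc n) =
     (\<Union>(a, b) \<in> cantor_intervals n. {(a, a + (b - a) / 4), (b - (b - a) / 4, b)})"

definition cantor_stage :: "nat \<Rightarrow> real set" where
  "cantor_stage n = (\<Union>(a, b) \<in> cantor_intervals n. {a..b})"

definition cantor_square :: "nat \<Rightarrow> complex set" where
  "cantor_square n = {Complex x y | x y. x \<in> cantor_stage n \<and> y \<in> cantor_stage n}"

definition Proj :: "real \<Rightarrow> complex \<Rightarrow> complex" where
  "Proj \<theta> z = complex_of_real (Re (z * cnj (cis \<theta>))) * cis \<theta>"

text \<open>One-dimensional Lebesgue measure of a subset of the line through 0 in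
  direction e^{i theta}, via the isometric parametrisation t \<mapsto> t e^{i theta}.\<close>
definition line_measure :: "real \<Rightarrow> complex set \<Rightarrow> ennreal" where
  "line_measure \<theta> S = emeasure lebesgue {t. complex_of_real t * cis \<theta> \<in> S}"

text \<open>Favard length of E with respect to T (lower Lebesgue integral over theta).\<close>
definition Fav :: "(complex \<Rightarrow> complex \<Rightarrow> complex) \<Rightarrow> complex set \<Rightarrow> ennreal" where
  "Fav T E = (\<integral>\<^sup>+ \<theta> \<in> {0..2*pi}. line_measure \<theta> (Proj \<theta> ` ((\<lambda>z. T z (cis \<theta>)) ` E)) \<partial>lborel)
             / ennreal (2 * pi)"

end

theory Submission
  imports Defs
begin

text \<open>The proof follows Bateman and Volberg. In the direction of slope 2 the lower-left corners of
  the \<open>4 ^ n\<close> squares of \<open>cantor_square n\<close> project to equally spaced points. Let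
  \<open>\<tau> = 2 ^ -k \<ge> 1 / n\<close> and consider slopes between \<open>2 + \<tau> / 2\<close> and \<open>2 + \<tau>\<close>. Two squares at
  distance comparable to \<open>4 ^ (m - n)\<close> whose shadows overlap for such a slope have indices that are
  close to, and on both sides of, a common multiple of \<open>4 ^ m\<close>, so there are only few of them, and
  the mean energy of the shadows over these slopes is \<open>O(n \<tau>)\<close>. The projection then has mean length
  at least of order \<open>1 / (n \<tau>)\<close>, so each of the about \<open>log n\<close> arcs contributes at least of order
  \<open>1 / n\<close>. A perturbation with Lipschitz constant below \<open>4 ^ -n\<close> moves the shadows of two squares
  relative to each other by a bounded multiple of the size of a square, which only affects
  constants.\<close>

section \<open>Digit sums\<close>

definition digit_sum :: "nat \<Rightarrow> (nat \<Rightarrow> real) \<Rightarrow> nat \<Rightarrow> nat \<Rightarrow> real" where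
  "digit_sum b w n i = (\<Sum>k<n. w (i div b ^ k mod b) * real b ^ k)"

lemma digit_sum_Suc:
  "digit_sum b w (Suc n) i = digit_sum b w n i + w (i div b ^ n mod b) * real b ^ n"
  by (simp add: digit_sum_def)

lemma digit_sum_Suc_shift:
  "digit_sum b w (Suc n) i = w (i mod b) + real b * digit_sum b w n (i div b)"
  unfolding digit_sum_def sum.lessThan_Suc_shift
  by (simp add: sum_distrib_left div_mult2_eq algebra_simps)

lemma digit_sum_of_nat: "digit_sum b real n i = real (i mod b ^ n)"
proof (induction n)
  case (Suc n)
  have "i mod b ^ Suc n = b ^ n * (i div b ^ n mod b) + i mod b ^ n"
    by (simp only: power_Suc2 mod_mult2_eq)
  with Suc show ?case by (simp add: digit_sum_Suc)
qed (simp add: digit_sum_def)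

lemma digit_sum_diff_eq:
  assumes "i div b ^ m = j div b ^ m" "m \<le> n"
  shows "digit_sum b w n i - digit_sum b w n j = digit_sum b w m i - digit_sum b w m j"
  using assms(2)
proof (induction n rule: dec_induct)
  case (step n)
  then have "i div b ^ n = j div b ^ n"
    using assms(1) by (metis div_mult2_eq le_add_diff_inverse power_add)
  with step.IH show ?case by (simp add: digit_sum_Suc)
qed simp

lemma abs_digit_sum_diff_le:
  assumes "0 < b" and w: "\<And>d e. d < b \<Longrightarrow> e < b \<Longrightarrow> \<bar>w d - w e\<bar> \<le> real b - 1"
  shows "\<bar>digit_sum b w n i - digit_sum b w n j\<bar> \<le> real b ^ n - 1"
proof (induction n)
  case (Suc n)
  let ?\<delta> = "w (i div b ^ n mod b) - w (j div b ^ n mod b)"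
  have "\<bar>?\<delta>\<bar> * real b ^ n \<le> (real b - 1) * real b ^ n"
    using \<open>0 < b\<close> by (intro mult_right_mono w) auto
  then have "\<bar>?\<delta> * real b ^ n\<bar> \<le> (real b - 1) * real b ^ n"
    by (simp add: abs_mult)
  with Suc show ?case by (simp add: digit_sum_Suc algebra_simps)
qed (simp add: digit_sum_def)

definition branch_level :: "nat \<Rightarrow> nat \<Rightarrow> nat \<Rightarrow> nat \<Rightarrow> bool" where
  "branch_level b i j m \<longleftrightarrow> i div b ^ Suc m = j div b ^ Suc m \<and> i div b ^ m \<noteq> j div b ^ m"

lemma branch_levelE:
  assumes "i \<noteq> j" "i < b ^ n" "j < b ^ n"
  obtains m where "m < n" "branch_level b i j m"
  using ex_least_nat_less[of "\<lambda>k. i div b ^ k = j div b ^ k" n] assms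
  by (auto simp: branch_level_def)

lemma digit_neq_at_branch_level:
  assumes "branch_level b i j m"
  shows "i div b ^ m mod b \<noteq> j div b ^ m mod b"
  using assms unfolding branch_level_def power_Suc2 div_mult2_eq by (metis div_mult_mod_eq)

lemma abs_digit_sum_diff_ge:
  assumes b: "0 < b" and w: "\<And>d e. d < b \<Longrightarrow> e < b \<Longrightarrow> \<bar>w d - w e\<bar> \<le> real b - 1"
    and m: "branch_level b i j m" "m < n"
  shows "\<bar>w (i div b ^ m mod b) - w (j div b ^ m mod b)\<bar> * real b ^ m - (real b ^ m - 1)
    \<le> \<bar>digit_sum b w n i - digit_sum b w n j\<bar>"
proof -
  let ?\<delta> = "w (i div b ^ m mod b) - w (j div b ^ m mod b)"
  have "digit_sum b w n i - digit_sum b w n j = digit_sum b w (Suc m) i - digit_sum b w (Suc m) j"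
    by (rule digit_sum_diff_eq) (use m in \<open>auto simp: branch_level_def\<close>)
  also have "\<dots> = ?\<delta> * real b ^ m + (digit_sum b w m i - digit_sum b w m j)"
    by (simp add: digit_sum_Suc algebra_simps)
  finally have "digit_sum b w n i - digit_sum b w n j = \<dots>" .
  moreover have "\<bar>digit_sum b w m i - digit_sum b w m j\<bar> \<le> real b ^ m - 1"
    by (rule abs_digit_sum_diff_le[OF b w])
  moreover have "\<bar>?\<delta> * real b ^ m\<bar> = \<bar>?\<delta>\<bar> * real b ^ m"
    by (simp add: abs_mult)
  ultimately show ?thesis by linarith
qed

section \<open>Corners of the Cantor squares\<close>

lemma digit_sum_in_cantor_intervals:
  assumes w: "\<And>d. w d \<in> {0, 3}"
  shows "(digit_sum 4 w n i / 4 ^ n, (digit_sum 4 w n i + 1) / 4 ^ n) \<in> cantor_intervals n"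
proof (induction n arbitrary: i)
  case (Suc n)
  have "w (i mod 4) = 0 \<or> w (i mod 4) = 3" using w[of "i mod 4"] by simp
  then show ?case
    unfolding cantor_intervals.simps digit_sum_Suc_shift
    by (intro UN_I[OF Suc[of "i div 4"]]) (auto simp: field_simps)
qed (simp add: digit_sum_def)

lemma Icc_subset_cantor_stage:
  "(a, b) \<in> cantor_intervals n \<Longrightarrow> {a..b} \<subseteq> cantor_stage n"
  by (auto simp: cantor_stage_def)

lemma compact_cantor_stage: "compact (cantor_stage n)"
proof -
  have "finite (cantor_intervals n)"
    by (induction n) auto
  then show ?thesis
    unfolding cantor_stage_def by (intro compact_UN) auto
qed

lemma compact_cantor_square: "compact (cantor_square n)"
proof -
  have "cantor_square n = (\<lambda>p. Complex (fst p) (snd p)) ` (cantor_stage n \<times> cantor_stage n)"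
    by (force simp: cantor_square_def)
  also have "compact \<dots>"
    by (intro compact_continuous_image compact_Times compact_cantor_stage)
       (auto simp: Complex_eq intro!: continuous_intros)
  finally show ?thesis .
qed

text \<open>The index \<open>i < 4 ^ n\<close> of a square records its position in base 4, the digits 0 to 3 numbering
  the four corner squares. The coordinates of its lower-left corner are measured in units of
  \<open>4 ^ -n\<close>, and its position along a line of slope \<open>s\<close> in units of \<open>4 ^ -n / sqrt (1 + s\<^sup>2)\<close>.\<close>

definition x_digit :: "nat \<Rightarrow> real" where
  "x_digit d = (if odd d then 3 else 0)"

definition y_digit :: "nat \<Rightarrow> real" where
  "y_digit d = (if d \<ge> 2 then 3 else 0)"

definition corner_x :: "nat \<Rightarrow> nat \<Rightarrow> real" where
  "corner_x = digit_sum 4 x_digit"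

definition corner_y :: "nat \<Rightarrow> nat \<Rightarrow> real" where
  "corner_y = digit_sum 4 y_digit"

definition corner :: "nat \<Rightarrow> nat \<Rightarrow> complex" where
  "corner n i = Complex (corner_x n i / 4 ^ n) (corner_y n i / 4 ^ n)"

definition corner_height :: "nat \<Rightarrow> real \<Rightarrow> nat \<Rightarrow> real" where
  "corner_height n s i = corner_x n i + s * corner_y n i"

lemma x_digit_plus_2_y_digit: "d < 4 \<Longrightarrow> x_digit d + 2 * y_digit d = 3 * real d"
proof -
  assume "d < 4"
  then consider "d = 0" | "d = 1" | "d = 2" | "d = 3" by linarith
  then show ?thesis by cases (simp_all add: x_digit_def y_digit_def)
qed

lemma corner_height_2: "corner_height n 2 i = 3 * real (i mod 4 ^ n)"
proof -
  have "corner_height n 2 i = digit_sum 4 (\<lambda>d. x_digit d + 2 * y_digit d) n i"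
    by (simp add: corner_height_def corner_x_def corner_y_def digit_sum_def sum_distrib_left
        sum.distrib[symmetric] algebra_simps)
  also have "\<dots> = 3 * digit_sum 4 real n i"
    by (simp add: digit_sum_def x_digit_plus_2_y_digit sum_distrib_left mult.assoc)
  finally show ?thesis by (simp add: digit_sum_of_nat)
qed

lemma abs_digit_diff_le:
  shows abs_x_digit_diff_le: "\<bar>x_digit d - x_digit e\<bar> \<le> 3"
    and abs_y_digit_diff_le: "\<bar>y_digit d - y_digit e\<bar> \<le> 3"
  by (simp_all add: x_digit_def y_digit_def)

lemma
  shows abs_corner_x_diff_le: "\<bar>corner_x n i - corner_x n j\<bar> \<le> 4 ^ n - 1"
    and abs_corner_y_diff_le: "\<bar>corner_y n i - corner_y n j\<bar> \<le> 4 ^ n - 1"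
  using abs_digit_sum_diff_le[of 4 x_digit n i j] abs_digit_sum_diff_le[of 4 y_digit n i j]
  by (simp_all add: corner_x_def corner_y_def abs_digit_diff_le)

lemma abs_corner_y_diff_le_at_branch_level:
  assumes "branch_level 4 i j m" "m < n"
  shows "\<bar>corner_y n i - corner_y n j\<bar> \<le> 4 ^ Suc m"
proof -
  have "corner_y n i - corner_y n j = corner_y (Suc m) i - corner_y (Suc m) j"
    unfolding corner_y_def by (rule digit_sum_diff_eq) (use assms in \<open>auto simp: branch_level_def\<close>)
  then show ?thesis using abs_corner_y_diff_le[of "Suc m" i j] by linarith
qed

lemma corner_separation:
  assumes m: "branch_level 4 i j m" "m < n"
  shows "2 * 4 ^ m \<le> \<bar>corner_x n i - corner_x n j\<bar> \<or> 2 * 4 ^ m \<le> \<bar>corner_y n i - corner_y n j\<bar>"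
proof -
  define d e where "d = i div 4 ^ m mod 4" and "e = j div 4 ^ m mod 4"
  have "d \<noteq> e" unfolding d_def e_def by (rule digit_neq_at_branch_level) fact
  moreover have "x_digit d + 2 * y_digit d = 3 * real d" "x_digit e + 2 * y_digit e = 3 * real e"
    by (simp_all add: x_digit_plus_2_y_digit d_def e_def)
  ultimately have "x_digit d \<noteq> x_digit e \<or> y_digit d \<noteq> y_digit e" by auto
  then consider (x) "\<bar>x_digit d - x_digit e\<bar> = 3" | (y) "\<bar>y_digit d - y_digit e\<bar> = 3"
    by (auto simp: x_digit_def y_digit_def split: if_splits)
  then show ?thesis
  proof cases
    case x
    then show ?thesis
      using abs_digit_sum_diff_ge[OF _ _ m, of x_digit]
      by (simp add: corner_x_def d_def e_def abs_x_digit_diff_le)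
  next
    case y
    then show ?thesis
      using abs_digit_sum_diff_ge[OF _ _ m, of y_digit]
      by (simp add: corner_y_def d_def e_def abs_y_digit_diff_le)
  qed
qed

lemma left_edge_subset_cantor_square:
  "closed_segment (corner n i) (corner n i + \<i> / 4 ^ n) \<subseteq> cantor_square n"
proof
  fix z assume "z \<in> closed_segment (corner n i) (corner n i + \<i> / 4 ^ n)"
  then obtain u where u: "0 \<le> u" "u \<le> 1" and z: "z = corner n i + u *\<^sub>R (\<i> / 4 ^ n)"
    by (auto simp: in_segment algebra_simps)
  have re: "Re z = corner_x n i / 4 ^ n" and im: "Im z = (corner_y n i + u) / 4 ^ n"
    by (simp_all add: z corner_def add_divide_distrib)
  have "{corner_x n i / 4 ^ n..(corner_x n i + 1) / 4 ^ n} \<subseteq> cantor_stage n"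
    "{corner_y n i / 4 ^ n..(corner_y n i + 1) / 4 ^ n} \<subseteq> cantor_stage n"
    unfolding corner_x_def corner_y_def
    by (intro Icc_subset_cantor_stage digit_sum_in_cantor_intervals;
        simp add: x_digit_def y_digit_def)+
  then have "Re z \<in> cantor_stage n" "Im z \<in> cantor_stage n"
    using u by (auto simp: re im divide_right_mono subset_iff)
  then show "z \<in> cantor_square n"
    by (metis (mono_tags, lifting) cantor_square_def complex.collapse mem_Collect_eq)
qed

section \<open>Covering and lower integrals\<close>

lemma indicator_fmeasurable:
  assumes "A \<in> fmeasurable M"
  shows integrable_indicator_fmeasurable: "integrable M (indicator A :: _ \<Rightarrow> real)"
    and integral_indicator_fmeasurable: "(LINT x|M. indicator A x) = measure M A"
  using assms by (auto simp: fmeasurable_def Int_absorb2 sets.sets_into_space)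

text \<open>With \<open>g\<close> the multiplicity function of the family, \<open>2 * c * g - (c * g)\<^sup>2 \<le> 1\<close>, with value 0
  off the union. This replaces the Cauchy-Schwarz inequality by a bound that is linear in the
  pairwise intersections, hence easy to integrate over the angle.\<close>

lemma measure_UN_ge_pairwise:
  fixes A :: "'i \<Rightarrow> 'a set" and c :: real
  assumes I: "finite I" and A: "\<And>i. i \<in> I \<Longrightarrow> A i \<in> fmeasurable M"
  shows "2 * c * (\<Sum>i\<in>I. measure M (A i)) - c\<^sup>2 * (\<Sum>i\<in>I. \<Sum>j\<in>I. measure M (A i \<inter> A j))
    \<le> measure M (\<Union>i\<in>I. A i)"
proof -
  define U where "U = (\<Union>i\<in>I. A i)"
  define g where "g x = (\<Sum>i\<in>I. indicator (A i) x :: real)" for x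
  have fmeasurable_Int: "A i \<inter> A j \<in> fmeasurable M" if "i \<in> I" "j \<in> I" for i j
    using A that by blast
  have U: "U \<in> fmeasurable M"
    unfolding U_def using I A by (intro fmeasurable.finite_UN) auto
  have g2: "(g x)\<^sup>2 = (\<Sum>i\<in>I. \<Sum>j\<in>I. indicator (A i \<inter> A j) x)" for x
    by (simp add: g_def power2_eq_square sum_product indicator_inter_arith)
  have g_int: "integrable M g" "integral\<^sup>L M g = (\<Sum>i\<in>I. measure M (A i))"
    unfolding g_def by (simp_all add: Bochner_Integration.integral_sum indicator_fmeasurable A)
  have g2_int: "integrable M (\<lambda>x. (g x)\<^sup>2)"
    "(LINT x|M. (g x)\<^sup>2) = (\<Sum>i\<in>I. \<Sum>j\<in>I. measure M (A i \<inter> A j))"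
    unfolding g2 by (simp_all add: Bochner_Integration.integral_sum indicator_fmeasurable fmeasurable_Int)
  have "2 * c * g x - c\<^sup>2 * (g x)\<^sup>2 \<le> indicator U x" for x
  proof (cases "x \<in> U")
    case True
    then show ?thesis
      using zero_le_power2[of "c * g x - 1"] by (simp add: power2_eq_square algebra_simps)
  next
    case False
    then have "g x = 0" unfolding g_def U_def by (intro sum.neutral) auto
    with False show ?thesis by simp
  qed
  then have "(LINT x|M. 2 * c * g x - c\<^sup>2 * (g x)\<^sup>2) \<le> (LINT x|M. indicator U x)"
    using g_int(1) g2_int(1) integrable_indicator_fmeasurable[OF U] by (intro integral_mono) auto
  moreover have "(LINT x|M. 2 * c * g x - c\<^sup>2 * (g x)\<^sup>2)
      = 2 * c * integral\<^sup>L M g - c\<^sup>2 * (LINT x|M. (g x)\<^sup>2)"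
    using g_int(1) g2_int(1) by simp
  ultimately show ?thesis
    by (simp only: g_int(2) g2_int(2) integral_indicator_fmeasurable[OF U] flip: U_def)
qed

lemma measure_Icc_Int_Icc_le:
  "0 \<le> l \<Longrightarrow> measure lborel ({x..x + l} \<inter> {y..y + l}) \<le> (if \<bar>x - y\<bar> \<le> l then l else (0 :: real))"
  by (auto simp: content_real_if)

lemma emeasure_ge_of_intervals:
  fixes v :: "'i \<Rightarrow> real"
  assumes I: "finite I" and "0 \<le> l" and K: "K \<in> sets lborel"
    and sub: "\<And>i. i \<in> I \<Longrightarrow> {v i..v i + l} \<subseteq> K"
  shows "ennreal (2 * c * l * real (card I)
      - c\<^sup>2 * l * real (card {p \<in> I \<times> I. \<bar>v (fst p) - v (snd p)\<bar> \<le> l})) \<le> emeasure lborel K"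
proof -
  define A where "A i = {v i..v i + l}" for i
  let ?P = "{p \<in> I \<times> I. \<bar>v (fst p) - v (snd p)\<bar> \<le> l}"
  have A: "A i \<in> fmeasurable lborel" for i
    using fmeasurable_cbox[of "v i" "v i + l"] by (simp add: A_def)
  then have U: "(\<Union>i\<in>I. A i) \<in> fmeasurable lborel"
    using I by (intro fmeasurable.finite_UN) auto
  have "(\<Sum>i\<in>I. \<Sum>j\<in>I. measure lborel (A i \<inter> A j)) \<le> (\<Sum>i\<in>I. \<Sum>j\<in>I. if \<bar>v i - v j\<bar> \<le> l then l else 0)"
    unfolding A_def by (intro sum_mono measure_Icc_Int_Icc_le \<open>0 \<le> l\<close>)
  also have "\<dots> = (\<Sum>p\<in>?P. l)"
    using I by (simp add: sum.cartesian_product split_def sum.inter_filter del: sum_constant)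
  finally have "c\<^sup>2 * (\<Sum>i\<in>I. \<Sum>j\<in>I. measure lborel (A i \<inter> A j)) \<le> c\<^sup>2 * (l * real (card ?P))"
    by (intro mult_left_mono) (simp_all add: mult.commute)
  moreover have "(\<Sum>i\<in>I. measure lborel (A i)) = l * real (card I)"
    using \<open>0 \<le> l\<close> by (simp add: A_def)
  ultimately have "2 * c * l * real (card I) - c\<^sup>2 * l * real (card ?P) \<le> measure lborel (\<Union>i\<in>I. A i)"
    using measure_UN_ge_pairwise[OF I, of A lborel c] A by (simp add: mult.assoc)
  then have "ennreal (2 * c * l * real (card I) - c\<^sup>2 * l * real (card ?P)) \<le> emeasure lborel (\<Union>i\<in>I. A i)"
    using emeasure_eq_measure2[OF U] by (simp add: ennreal_leI)
  also have "\<dots> \<le> emeasure lborel K"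
    using sub K by (intro emeasure_mono) (auto simp: A_def)
  finally show ?thesis .
qed

text \<open>No measurability is assumed here: the maps may depend on the direction arbitrarily, so the
  integrals over the angle are lower integrals.\<close>

lemma nn_integral_superadditive:
  "integral\<^sup>N M f + integral\<^sup>N M g \<le> (\<integral>\<^sup>+ x. f x + g x \<partial>M)"
proof -
  let ?S = "\<lambda>f :: 'a \<Rightarrow> ennreal. {s. simple_function M s \<and> s \<le> f}"
  have "(\<lambda>_. 0) \<in> ?S h" for h by (simp add: le_fun_def)
  then have ne: "?S h \<noteq> {}" for h by blast
  have "integral\<^sup>S M s + integral\<^sup>S M t \<le> (\<integral>\<^sup>+ x. f x + g x \<partial>M)" if "s \<in> ?S f" "t \<in> ?S g" for s t
  proof -
    have "integral\<^sup>S M s + integral\<^sup>S M t = (\<integral>\<^sup>+ x. s x + t x \<partial>M)"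
      using that by (simp add: nn_integral_add nn_integral_eq_simple_integral
            borel_measurable_simple_function)
    also have "\<dots> \<le> (\<integral>\<^sup>+ x. f x + g x \<partial>M)"
      using that by (intro nn_integral_mono add_mono) (auto simp: le_fun_def)
    finally show ?thesis .
  qed
  then have "(SUP s\<in>?S f. SUP t\<in>?S g. integral\<^sup>S M s + integral\<^sup>S M t) \<le> (\<integral>\<^sup>+ x. f x + g x \<partial>M)"
    by (intro SUP_least)
  moreover have "(SUP s\<in>?S f. SUP t\<in>?S g. integral\<^sup>S M s + integral\<^sup>S M t)
      = integral\<^sup>N M f + integral\<^sup>N M g"
    unfolding nn_integral_def[of M f] nn_integral_def[of M g]
    by (simp only: ennreal_SUP_add_left[OF ne] ennreal_SUP_add_right[OF ne, symmetric])
  ultimately show ?thesis by simp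
qed

lemma sum_nn_integral_le: "(\<Sum>i\<in>I. integral\<^sup>N M (f i)) \<le> (\<integral>\<^sup>+ x. (\<Sum>i\<in>I. f i x) \<partial>M)"
proof (induction I rule: infinite_finite_induct)
  case (insert i I)
  then have "integral\<^sup>N M (f i) + (\<Sum>i\<in>I. integral\<^sup>N M (f i))
      \<le> integral\<^sup>N M (f i) + (\<integral>\<^sup>+ x. (\<Sum>i\<in>I. f i x) \<partial>M)"
    by (intro add_left_mono)
  also have "\<dots> \<le> (\<integral>\<^sup>+ x. f i x + (\<Sum>i\<in>I. f i x) \<partial>M)"
    by (rule nn_integral_superadditive)
  finally show ?case
    using insert.hyps by simp
qed simp_all

lemma sum_nn_integral_disjoint_le:
  fixes f :: "'a \<Rightarrow> ennreal"
  assumes "finite I" "disjoint_family_on A I" "\<And>i. i \<in> I \<Longrightarrow> A i \<subseteq> B"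
  shows "(\<Sum>i\<in>I. \<integral>\<^sup>+ x \<in> A i. f x \<partial>M) \<le> (\<integral>\<^sup>+ x \<in> B. f x \<partial>M)"
proof -
  have "(\<Sum>i\<in>I. \<integral>\<^sup>+ x \<in> A i. f x \<partial>M) \<le> (\<integral>\<^sup>+ x. (\<Sum>i\<in>I. f x * indicator (A i) x) \<partial>M)"
    by (rule sum_nn_integral_le)
  also have "\<dots> = (\<integral>\<^sup>+ x. f x * indicator (\<Union>i\<in>I. A i) x \<partial>M)"
    using assms by (simp only: indicator_UN_disjoint sum_distrib_left)
  also have "\<dots> \<le> (\<integral>\<^sup>+ x \<in> B. f x \<partial>M)"
    using assms(3) by (intro nn_integral_mono mult_left_mono) (auto simp: indicator_def)
  finally show ?thesis .
qed

lemma ennreal_integral_le_nn_integral: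
  fixes f :: "'a \<Rightarrow> real"
  assumes "integrable M f"
  shows "ennreal (integral\<^sup>L M f) \<le> (\<integral>\<^sup>+ x. ennreal (f x) \<partial>M)"
proof -
  have "integral\<^sup>L M f \<le> enn2real (\<integral>\<^sup>+ x. ennreal (f x) \<partial>M)"
    by (simp add: real_lebesgue_integral_def[OF assms])
  then have "ennreal (integral\<^sup>L M f) \<le> ennreal (enn2real (\<integral>\<^sup>+ x. ennreal (f x) \<partial>M))"
    by (rule ennreal_leI)
  also have "\<dots> \<le> (\<integral>\<^sup>+ x. ennreal (f x) \<partial>M)"
    by (simp add: ennreal_enn2real_if)
  finally show ?thesis .
qed

lemma nn_integral_ge_of_card_bound:
  fixes f :: "'a \<Rightarrow> ennreal" and a b :: real
  assumes P: "finite P" and A: "A \<in> fmeasurable M"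
    and E: "\<And>p. p \<in> P \<Longrightarrow> E p \<in> sets M" "\<And>p. p \<in> P \<Longrightarrow> E p \<subseteq> A"
    and f: "\<And>x. x \<in> A \<Longrightarrow> ennreal (a - b * real (card {p \<in> P. x \<in> E p})) \<le> f x"
  shows "ennreal (a * measure M A - b * (\<Sum>p\<in>P. measure M (E p))) \<le> (\<integral>\<^sup>+ x \<in> A. f x \<partial>M)"
proof -
  define h where "h x = a * indicator A x - b * (\<Sum>p\<in>P. indicator (E p) x)" for x
  have fmeasurable_E: "E p \<in> fmeasurable M" if "p \<in> P" for p
    using fmeasurableI2[OF A] E that by blast
  have h: "integrable M h" "integral\<^sup>L M h = a * measure M A - b * (\<Sum>p\<in>P. measure M (E p))"
    unfolding h_def by (simp_all add: indicator_fmeasurable A fmeasurable_E)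
  have "ennreal (h x) \<le> f x * indicator A x" for x
  proof (cases "x \<in> A")
    case True
    have "(\<Sum>p\<in>P. indicator (E p) x :: real) = real (card {p \<in> P. x \<in> E p})"
      using P by (simp add: indicator_def sum.If_cases Int_def)
    with f[OF True] True show ?thesis by (simp add: h_def)
  next
    case False
    then have "(\<Sum>p\<in>P. indicator (E p) x :: real) = 0"
      using E(2) by (intro sum.neutral ballI indicator_simps(2)) blast
    with False show ?thesis by (simp add: h_def)
  qed
  then have "(\<integral>\<^sup>+ x. ennreal (h x) \<partial>M) \<le> (\<integral>\<^sup>+ x \<in> A. f x \<partial>M)"
    by (intro nn_integral_mono)
  with ennreal_integral_le_nn_integral[OF h(1)] show ?thesis
    unfolding h(2) by (rule order_trans)
qed

section \<open>Projections\<close>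

definition shadow :: "real \<Rightarrow> complex \<Rightarrow> real" where
  "shadow \<theta> z = Re (z * cnj (cis \<theta>))"

lemma line_measure_Proj: "line_measure \<theta> (Proj \<theta> ` E) = emeasure lebesgue (shadow \<theta> ` E)"
proof -
  have "{t. complex_of_real t * cis \<theta> \<in> Proj \<theta> ` E} = shadow \<theta> ` E"
    by (auto simp: Proj_def shadow_def simp del: times_complex.sel)
  then show ?thesis by (simp add: line_measure_def)
qed

lemma shadow_diff: "shadow \<theta> (z - w) = shadow \<theta> z - shadow \<theta> w"
  by (simp add: shadow_def algebra_simps)

lemma continuous_on_shadow: "continuous_on A (shadow \<theta>)"
  unfolding shadow_def by (intro continuous_intros)

lemma abs_shadow_le: "\<bar>shadow \<theta> z\<bar> \<le> cmod z"
  using abs_Re_le_cmod[of "z * cnj (cis \<theta>)"]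
  by (simp only: shadow_def norm_mult complex_mod_cnj norm_cis mult_1_right)

lemma shadow_arctan: "shadow (arctan s) (Complex x y) = (x + s * y) / sqrt (1 + s\<^sup>2)"
  by (simp add: shadow_def cos_arctan sin_arctan add_divide_distrib)

lemma shadow_perturbation:
  assumes "L-lipschitz_on UNIV (\<lambda>z. S z - z)"
  shows "\<bar>(shadow \<theta> (S z) - shadow \<theta> (S w)) - shadow \<theta> (z - w)\<bar> \<le> L * cmod (z - w)"
proof -
  have "(shadow \<theta> (S z) - shadow \<theta> (S w)) - shadow \<theta> (z - w) = shadow \<theta> ((S z - z) - (S w - w))"
    by (simp add: shadow_diff)
  also have "\<bar>\<dots>\<bar> \<le> cmod ((S z - z) - (S w - w))" by (rule abs_shadow_le)
  also have "\<dots> \<le> L * cmod (z - w)"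
    using lipschitz_onD[OF assms, of z w] by (simp add: dist_norm)
  finally show ?thesis .
qed

lemma continuous_on_if_lipschitz_diff:
  fixes S :: "'a::real_normed_vector \<Rightarrow> 'a"
  assumes "L-lipschitz_on A (\<lambda>z. S z - z)"
  shows "continuous_on A S"
proof -
  have "continuous_on A (\<lambda>z. (S z - z) + z)"
    by (intro continuous_on_add lipschitz_on_continuous_on[OF assms] continuous_on_id)
  then show ?thesis by simp
qed

lemma continuous_on_shadow_perturbation:
  assumes "L-lipschitz_on UNIV (\<lambda>z. S z - z)"
  shows "continuous_on A (\<lambda>z. shadow \<theta> (S z))"
  using continuous_on_compose2[OF continuous_on_shadow continuous_on_if_lipschitz_diff[OF assms]]
  by (rule continuous_on_subset) auto

lemma shadow_perturbed_segment_superset: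
  assumes lip: "L-lipschitz_on UNIV (\<lambda>z. S z - z)" and l: "l \<le> shadow \<theta> e - L * cmod e"
  shows "{shadow \<theta> (S z)..shadow \<theta> (S z) + l} \<subseteq> (\<lambda>w. shadow \<theta> (S w)) ` closed_segment z (z + e)"
proof -
  let ?f = "\<lambda>w. shadow \<theta> (S w)"
  have "connected (?f ` closed_segment z (z + e))"
    by (intro connected_continuous_image continuous_on_shadow_perturbation[OF lip] connected_segment)
  then have "{?f z..?f (z + e)} \<subseteq> ?f ` closed_segment z (z + e)"
    by (rule connected_contains_Icc) auto
  moreover have "?f z + l \<le> ?f (z + e)"
    using shadow_perturbation[OF lip, of \<theta> "z + e" z] l by simp
  ultimately show ?thesis by fastforce
qed

lemma sqrt_one_plus_square_bounds:
  fixes s :: real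
  assumes "2 \<le> s" "s \<le> 3"
  shows "sqrt (1 + s\<^sup>2) \<le> 16 / 5" and "3 / 4 \<le> s / sqrt (1 + s\<^sup>2)"
proof -
  have s2: "4 \<le> s\<^sup>2" "s\<^sup>2 \<le> 9"
    using power_mono[OF assms(1), of 2] power_mono[OF assms(2), of 2] assms by auto
  show "sqrt (1 + s\<^sup>2) \<le> 16 / 5"
    by (rule real_le_lsqrt) (use s2 in \<open>auto simp: power2_eq_square\<close>)
  have "sqrt (1 + s\<^sup>2) \<le> 4 / 3 * s"
    by (rule real_le_lsqrt) (use s2 assms in \<open>auto simp: power_mult_distrib power2_eq_square\<close>)
  moreover have "0 < sqrt (1 + s\<^sup>2)" using s2 by simp
  ultimately show "3 / 4 \<le> s / sqrt (1 + s\<^sup>2)" by (simp add: field_simps)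
qed

lemma cmod_corner_diff_le: "cmod (corner n i - corner n j) \<le> 2"
proof -
  have "\<bar>(corner_x n i - corner_x n j) / 4 ^ n\<bar> \<le> 1" "\<bar>(corner_y n i - corner_y n j) / 4 ^ n\<bar> \<le> 1"
    using abs_corner_x_diff_le[of n i j] abs_corner_y_diff_le[of n i j] by (simp_all add: abs_divide)
  then show ?thesis
    using cmod_le[of "corner n i - corner n j"] by (simp add: corner_def diff_divide_distrib)
qed

lemma shadow_corner_diff:
  "shadow (arctan s) (corner n i - corner n j) =
    (corner_height n s i - corner_height n s j) / (4 ^ n * sqrt (1 + s\<^sup>2))"
proof -
  have "corner n i - corner n j =
      Complex ((corner_x n i - corner_x n j) / 4 ^ n) ((corner_y n i - corner_y n j) / 4 ^ n)"
    by (simp add: corner_def complex_eq_iff diff_divide_distrib)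
  then show ?thesis
    by (simp add: shadow_arctan corner_height_def add_divide_distrib diff_divide_distrib algebra_simps)
qed

definition close_pairs :: "nat \<Rightarrow> real \<Rightarrow> (nat \<times> nat) set" where
  "close_pairs n s =
    {(i, j) \<in> {..<4 ^ n} \<times> {..<4 ^ n}. \<bar>corner_height n s i - corner_height n s j\<bar> \<le> 8}"

lemma corner_height_diff_le_of_perturbed_shadow_diff_le:
  assumes s: "2 \<le> s" "s \<le> 3"
    and L: "L \<le> (1 / 4) ^ n" and lip: "L-lipschitz_on UNIV (\<lambda>z. S z - z)"
    and near: "\<bar>shadow (arctan s) (S (corner n i)) - shadow (arctan s) (S (corner n j))\<bar>
      \<le> 1 / 2 * (1 / 4) ^ n"
  shows "\<bar>corner_height n s i - corner_height n s j\<bar> \<le> 8"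
proof -
  define r where "r = sqrt (1 + s\<^sup>2)"
  have r: "0 < r" "r \<le> 16 / 5"
    using sqrt_one_plus_square_bounds(1)[OF s] by (auto simp: r_def add_pos_nonneg)
  have "L * cmod (corner n i - corner n j) \<le> (1 / 4) ^ n * 2"
    using L lipschitz_on_nonneg[OF lip] by (intro mult_mono cmod_corner_diff_le) auto
  then have "\<bar>shadow (arctan s) (corner n i - corner n j)\<bar> \<le> 5 / 2 * (1 / 4) ^ n"
    using shadow_perturbation[OF lip, of "arctan s" "corner n i" "corner n j"] near by linarith
  then have "\<bar>corner_height n s i - corner_height n s j\<bar> \<le> 5 / 2 * r"
    unfolding shadow_corner_diff r_def[symmetric]
    using r by (simp add: abs_divide abs_mult power_one_over field_simps)
  with r show ?thesis by simp
qed

lemma perturbed_left_edge_shadow_ge: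
  assumes "1 \<le> n" and s: "2 \<le> s" "s \<le> 3" and L: "L \<le> (1 / 4) ^ n"
  shows "1 / 2 * (1 / 4) ^ n \<le> shadow (arctan s) (\<i> / 4 ^ n) - L * cmod (\<i> / 4 ^ n)"
proof -
  have "\<i> / 4 ^ n = Complex 0 ((1 / 4) ^ n)"
    by (simp add: complex_eq_iff power_one_over)
  then have "shadow (arctan s) (\<i> / 4 ^ n) = s / sqrt (1 + s\<^sup>2) * (1 / 4) ^ n"
    by (simp add: shadow_arctan)
  moreover have "3 / 4 * (1 / 4) ^ n \<le> s / sqrt (1 + s\<^sup>2) * (1 / 4) ^ n"
    by (intro mult_right_mono sqrt_one_plus_square_bounds s) simp
  moreover have "(1 / 4 :: real) ^ n \<le> (1 / 4) ^ 1"
    using \<open>1 \<le> n\<close> by (intro power_decreasing) auto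
  then have "L * (1 / 4) ^ n \<le> 1 / 4 * (1 / 4) ^ n"
    using L by (intro mult_right_mono) auto
  then have "L * cmod (\<i> / 4 ^ n) \<le> 1 / 4 * (1 / 4) ^ n"
    by (simp add: norm_divide norm_power power_one_over)
  ultimately show ?thesis by linarith
qed

lemma line_measure_perturbed_cantor_square_ge:
  assumes "1 \<le> n" and s: "2 \<le> s" "s \<le> 3"
    and L: "L \<le> (1 / 4) ^ n" and lip: "L-lipschitz_on UNIV (\<lambda>z. S z - z)"
  shows "ennreal (c - c\<^sup>2 / (2 * 4 ^ n) * real (card (close_pairs n s)))
    \<le> line_measure (arctan s) (Proj (arctan s) ` S ` cantor_square n)"
proof -
  let ?f = "\<lambda>z. shadow (arctan s) (S z)"
  define l :: real where "l = 1 / 2 * (1 / 4) ^ n"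
  let ?I = "{..<(4 :: nat) ^ n}"
  let ?V = "{p \<in> ?I \<times> ?I. \<bar>?f (corner n (fst p)) - ?f (corner n (snd p))\<bar> \<le> l}"
  have K: "?f ` cantor_square n \<in> sets lborel"
    using compact_continuous_image[OF continuous_on_shadow_perturbation[OF lip] compact_cantor_square]
    by (simp add: borel_compact)
  have "{?f (corner n i)..?f (corner n i) + l} \<subseteq> ?f ` cantor_square n" for i
    using shadow_perturbed_segment_superset[OF lip perturbed_left_edge_shadow_ge[OF \<open>1 \<le> n\<close> s L]]
      image_mono[OF left_edge_subset_cantor_square] unfolding l_def by (rule order_trans)
  then have "ennreal (2 * c * l * real (card ?I) - c\<^sup>2 * l * real (card ?V))
      \<le> emeasure lborel (?f ` cantor_square n)"
    by (intro emeasure_ge_of_intervals K) (auto simp: l_def)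
  moreover have "c - c\<^sup>2 / (2 * 4 ^ n) * real (card (close_pairs n s))
      \<le> 2 * c * l * real (card ?I) - c\<^sup>2 * l * real (card ?V)"
  proof -
    have "?V \<subseteq> close_pairs n s"
      using corner_height_diff_le_of_perturbed_shadow_diff_le[OF s L lip]
      by (auto simp: close_pairs_def l_def)
    moreover have "finite (close_pairs n s)"
      by (rule finite_subset[of _ "?I \<times> ?I"]) (auto simp: close_pairs_def)
    ultimately have "card ?V \<le> card (close_pairs n s)" by (rule card_mono[rotated])
    then have "c\<^sup>2 * l * real (card ?V) \<le> c\<^sup>2 * l * real (card (close_pairs n s))"
      by (intro mult_left_mono) (auto simp: l_def)
    then show ?thesis by (simp add: l_def power_one_over)
  qed
  ultimately have "ennreal (c - c\<^sup>2 / (2 * 4 ^ n) * real (card (close_pairs n s)))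
      \<le> emeasure lborel (?f ` cantor_square n)"
    using ennreal_leI order_trans by blast
  then show ?thesis
    using K by (subst line_measure_Proj) (simp add: image_image)
qed

section \<open>Pairs of indices separated by a multiple\<close>

lemma card_ordered_straddling_pairs_le:
  fixes q k r :: nat
  shows "card {(i, j). i < j \<and> j < k * q \<and> i div q \<noteq> j div q \<and> j - i \<le> r} \<le> k * r\<^sup>2"
proof -
  let ?S = "{(i, j). i < j \<and> j < k * q \<and> i div q \<noteq> j div q \<and> j - i \<le> r}"
  define f where "f p = (snd p div q, snd p mod q, snd p - fst p - 1)" for p :: "nat \<times> nat"
  have "inj_on f ?S"
  proof (rule inj_onI)
    fix x y assume xy: "x \<in> ?S" "y \<in> ?S" "f x = f y"
    then have "snd x = snd y" unfolding f_def by (metis Pair_inject div_mult_mod_eq)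
    with xy show "x = y" by (auto simp: f_def)
  qed
  moreover have "f ` ?S \<subseteq> {..<k} \<times> ({..<r} \<times> {..<r})"
  proof (rule image_subsetI)
    fix x assume "x \<in> ?S"
    then obtain i j where x: "x = (i, j)"
      and ij: "i < j" "j < k * q" "i div q \<noteq> j div q" "j - i \<le> r" by auto
    have "0 < q" using ij(2) by (cases q) auto
    moreover have "i div q < j div q" using ij div_le_mono[of i j q] by simp
    ultimately have "i < j div q * q" by (simp add: div_less_iff_less_mult)
    moreover have "j = j div q * q + j mod q" by simp
    ultimately have "j mod q < r" using ij by linarith
    then show "f x \<in> {..<k} \<times> ({..<r} \<times> {..<r})"
      using ij by (auto simp: x f_def less_mult_imp_div_less)
  qed
  ultimately have "card ?S \<le> card ({..<k} \<times> ({..<r} \<times> {..<r}))"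
    by (intro card_inj_on_le) auto
  then show ?thesis by (simp add: card_cartesian_product power2_eq_square)
qed

text \<open>A close pair of indices with different quotients by \<open>q\<close> lies on both sides of a multiple
  of \<open>q\<close>, and both members are near it; this makes the count quadratic in \<open>R\<close>.\<close>

lemma card_straddling_pairs_le:
  fixes q k :: nat and R :: real
  assumes "0 \<le> R"
  shows "real (card {(i, j). i < k * q \<and> j < k * q \<and> i div q \<noteq> j div q \<and> \<bar>real i - real j\<bar> \<le> R})
    \<le> 2 * real k * R\<^sup>2"
proof -
  define r where "r = nat \<lfloor>R\<rfloor>"
  let ?A = "{(i, j). i < k * q \<and> j < k * q \<and> i div q \<noteq> j div q \<and> \<bar>real i - real j\<bar> \<le> R}"
  define S where "S = {(i, j). i < j \<and> j < k * q \<and> i div q \<noteq> j div q \<and> j - i \<le> r}"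
  have S: "finite S"
    unfolding S_def by (rule finite_subset[of _ "{..<k * q} \<times> {..<k * q}"]) auto
  have "(i, j) \<in> S \<union> prod.swap ` S" if "(i, j) \<in> ?A" for i j
  proof (cases "i < j")
    case True
    with that have "(i, j) \<in> S" by (auto simp: S_def r_def le_nat_floor of_nat_diff)
    then show ?thesis by simp
  next
    case False
    with that have "(j, i) \<in> S"
      by (cases "i = j") (auto simp: S_def r_def le_nat_floor of_nat_diff)
    then show ?thesis by (metis UnCI image_eqI swap_simp)
  qed
  then have "card ?A \<le> card (S \<union> prod.swap ` S)"
    using S by (intro card_mono subrelI) auto
  also have "\<dots> \<le> card S + card (prod.swap ` S)" by (rule card_Un_le)
  also have "\<dots> \<le> 2 * card S" using card_image_le[OF S, of prod.swap] by simp
  also have "\<dots> \<le> 2 * (k * r\<^sup>2)"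
    unfolding S_def by (intro mult_left_mono card_ordered_straddling_pairs_le) simp
  finally have "real (card ?A) \<le> real (2 * (k * r\<^sup>2))" by (simp only: of_nat_le_iff)
  also have "\<dots> \<le> 2 * real k * R\<^sup>2"
    using \<open>0 \<le> R\<close> by (simp add: r_def mult_left_mono power_mono of_nat_floor)
  finally show ?thesis .
qed

section \<open>Angles of close pairs\<close>

lemma abs_arctan_diff_le: "\<bar>arctan a - arctan b\<bar> \<le> \<bar>a - b\<bar>"
proof -
  have "norm (inverse (1 + x\<^sup>2)) \<le> 1" for x :: real
    by (simp add: inverse_le_1_iff)
  then show ?thesis
    using field_differentiable_bound[of UNIV arctan "\<lambda>x. inverse (1 + x\<^sup>2)" 1 a b] DERIV_arctan
    by simp
qed

lemma arctan_diff_ge: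
  assumes "\<bar>a\<bar> \<le> M" "\<bar>b\<bar> \<le> M" "a \<le> b"
  shows "(b - a) / (1 + M\<^sup>2) \<le> arctan b - arctan a"
proof (cases "a = b")
  case False
  then obtain x where x: "a < x" "x < b" "arctan b - arctan a = (b - a) * inverse (1 + x\<^sup>2)"
    using MVT2[of a b arctan "\<lambda>x. inverse (1 + x\<^sup>2)"] DERIV_arctan \<open>a \<le> b\<close> by auto
  have "\<bar>x\<bar> \<le> \<bar>M\<bar>" using x assms by linarith
  then have "x\<^sup>2 \<le> M\<^sup>2" by (simp add: abs_le_square_iff)
  then have "inverse (1 + M\<^sup>2) \<le> inverse (1 + x\<^sup>2)"
    by (intro le_imp_inverse_le) (auto intro: add_pos_nonneg)
  then show ?thesis
    unfolding x(3) divide_inverse using \<open>a \<le> b\<close> by (intro mult_left_mono) auto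
qed simp

lemma arctan_IocE:
  assumes "\<theta> \<in> {arctan a<..arctan b}"
  obtains s where "\<theta> = arctan s" "a < s" "s \<le> b"
proof
  have "- (pi / 2) < \<theta>" "\<theta> < pi / 2"
    using assms arctan_bounded[of a] arctan_bounded[of b] by auto
  then show "\<theta> = arctan (tan \<theta>)" by (simp add: arctan_tan)
  with assms show "a < tan \<theta>" "tan \<theta> \<le> b"
    by (metis arctan_less_iff greaterThanAtMost_iff, metis arctan_le_iff greaterThanAtMost_iff)
qed

lemma measure_le_diameter:
  fixes A :: "real set"
  assumes "0 \<le> D" and D: "\<And>x y. x \<in> A \<Longrightarrow> y \<in> A \<Longrightarrow> \<bar>x - y\<bar> \<le> D" and A: "A \<in> sets borel"
  shows "measure lborel A \<le> D"
proof (cases "A = {}")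
  case False
  then obtain a where "a \<in> A" by auto
  have "x \<in> {a - D..a + D}" if "x \<in> A" for x
    using D[OF that \<open>a \<in> A\<close>] by (simp add: abs_le_iff)
  then have bdd: "bdd_above A" "bdd_below A"
    by (auto intro: bdd_aboveI[of _ "a + D"] bdd_belowI[of _ "a - D"])
  have "Sup A - D \<le> y" if "y \<in> A" for y
  proof -
    have "Sup A \<le> y + D"
      using False D that by (intro cSup_least) (force simp: abs_le_iff)+
    then show ?thesis by simp
  qed
  then have "Sup A - D \<le> Inf A"
    using False by (intro cInf_greatest)
  moreover have "Inf A \<le> Sup A"
    using cInf_lower[OF \<open>a \<in> A\<close> bdd(2)] cSup_upper[OF \<open>a \<in> A\<close> bdd(1)] by linarith
  moreover have "measure lborel A \<le> measure lborel {Inf A..Sup A}"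
    using A fmeasurable_cbox[of "Inf A" "Sup A"]
    by (intro measure_mono_fmeasurable) (auto simp: cInf_lower cSup_upper bdd)
  ultimately show ?thesis by simp
qed (use \<open>0 \<le> D\<close> in simp)

lemma borel_measurable_tan [measurable]: "(tan :: real \<Rightarrow> real) \<in> borel_measurable borel"
  unfolding tan_def by measurable

lemma measure_arctan_strip_le:
  fixes x y h a b :: real
  assumes "y \<noteq> 0" "0 \<le> h"
  shows "measure lborel {\<theta> \<in> {arctan a<..arctan b}. \<bar>x + tan \<theta> * y\<bar> \<le> h} \<le> 2 * h / \<bar>y\<bar>"
proof (rule measure_le_diameter)
  let ?A = "{\<theta> \<in> {arctan a<..arctan b}. \<bar>x + tan \<theta> * y\<bar> \<le> h}"
  have slope: "\<exists>s. \<theta> = arctan s \<and> \<bar>x + s * y\<bar> \<le> h" if "\<theta> \<in> ?A" for \<theta>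
  proof -
    from that have "\<theta> \<in> {arctan a<..arctan b}" by simp
    then obtain s where "\<theta> = arctan s" by (rule arctan_IocE)
    with that show ?thesis by (auto simp: tan_arctan)
  qed
  fix \<theta> \<phi> assume "\<theta> \<in> ?A" "\<phi> \<in> ?A"
  then obtain s t where \<theta>: "\<theta> = arctan s" "\<bar>x + s * y\<bar> \<le> h"
    and \<phi>: "\<phi> = arctan t" "\<bar>x + t * y\<bar> \<le> h"
    using slope by blast
  have "\<bar>s - t\<bar> * \<bar>y\<bar> = \<bar>(x + s * y) - (x + t * y)\<bar>"
    by (simp add: abs_mult[symmetric] algebra_simps)
  also have "\<dots> \<le> 2 * h" using \<theta>(2) \<phi>(2) by linarith
  finally have "\<bar>s - t\<bar> \<le> 2 * h / \<bar>y\<bar>"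
    using \<open>y \<noteq> 0\<close> by (simp add: field_simps)
  with abs_arctan_diff_le[of s t] show "\<bar>\<theta> - \<phi>\<bar> \<le> 2 * h / \<bar>y\<bar>"
    by (simp add: \<theta> \<phi>)
next
  show "{\<theta> \<in> {arctan a<..arctan b}. \<bar>x + tan \<theta> * y\<bar> \<le> h} \<in> sets borel"
    by measurable
qed (use \<open>0 \<le> h\<close> in simp)

definition slope_arc :: "real \<Rightarrow> real set" where
  "slope_arc \<tau> = {arctan (2 + \<tau> / 2)<..arctan (2 + \<tau>)}"

definition close_angles :: "nat \<Rightarrow> real \<Rightarrow> nat \<Rightarrow> nat \<Rightarrow> real set" where
  "close_angles n \<tau> i j =
    {\<theta> \<in> slope_arc \<tau>. \<bar>corner_height n (tan \<theta>) i - corner_height n (tan \<theta>) j\<bar> \<le> 8}"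

lemma slope_arcE:
  assumes "\<theta> \<in> slope_arc \<tau>"
  obtains s where "\<theta> = arctan s" "2 + \<tau> / 2 < s" "s \<le> 2 + \<tau>"
  using assms unfolding slope_arc_def by (rule arctan_IocE)

lemma fmeasurable_slope_arc: "slope_arc \<tau> \<in> fmeasurable lborel"
  using emeasure_bounded_finite[of "slope_arc \<tau>"] by (auto intro!: fmeasurableI simp: slope_arc_def)

lemma measure_slope_arc_bounds:
  assumes "0 < \<tau>" "\<tau> \<le> 1"
  shows "\<tau> / 20 \<le> measure lborel (slope_arc \<tau>)" and "measure lborel (slope_arc \<tau>) \<le> \<tau> / 2"
proof -
  have "arctan (2 + \<tau> / 2) \<le> arctan (2 + \<tau>)"
    using assms by (simp add: arctan_le_iff)
  then have "measure lborel (slope_arc \<tau>) = arctan (2 + \<tau>) - arctan (2 + \<tau> / 2)"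
    by (simp add: slope_arc_def measure_def)
  then show "\<tau> / 20 \<le> measure lborel (slope_arc \<tau>)" "measure lborel (slope_arc \<tau>) \<le> \<tau> / 2"
    using arctan_diff_ge[of "2 + \<tau> / 2" 3 "2 + \<tau>"] abs_arctan_diff_le[of "2 + \<tau>" "2 + \<tau> / 2"] assms
    by simp_all
qed

lemma corner_height_diff:
  "corner_height n s i - corner_height n s j =
    (corner_x n i - corner_x n j) + s * (corner_y n i - corner_y n j)"
  by (simp add: corner_height_def algebra_simps)

lemma borel_close_angles [measurable]: "close_angles n \<tau> i j \<in> sets borel"
  unfolding close_angles_def slope_arc_def corner_height_def by measurable

lemma close_angles_subset_slope_arc: "close_angles n \<tau> i j \<subseteq> slope_arc \<tau>"
  by (auto simp: close_angles_def)

lemma measure_close_angles_le: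
  assumes "0 < \<tau>" "\<tau> \<le> 1"
  shows "measure lborel (close_angles n \<tau> i j) \<le> \<tau> / 2"
proof -
  have "measure lborel (close_angles n \<tau> i j) \<le> measure lborel (slope_arc \<tau>)"
    using borel_close_angles
    by (intro measure_mono_fmeasurable close_angles_subset_slope_arc fmeasurable_slope_arc) simp
  then show ?thesis using measure_slope_arc_bounds[OF assms] by simp
qed

lemma close_anglesE:
  assumes "\<theta> \<in> close_angles n \<tau> i j"
  obtains s where "\<theta> = arctan s" "2 + \<tau> / 2 < s" "s \<le> 2 + \<tau>"
    "\<bar>(corner_x n i - corner_x n j) + s * (corner_y n i - corner_y n j)\<bar> \<le> 8"
  using assms by (auto simp: close_angles_def tan_arctan corner_height_diff elim!: slope_arcE)

lemma measure_close_angles_le_at_branch_level: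
  assumes \<tau>: "0 < \<tau>" "\<tau> \<le> 1" and m: "branch_level 4 i j m" "m < n"
  shows "measure lborel (close_angles n \<tau> i j) \<le> 48 / 4 ^ m"
proof -
  consider (empty) "close_angles n \<tau> i j = {}" | (small) "(4 :: real) ^ m \<le> 8"
    | (large) "close_angles n \<tau> i j \<noteq> {}" "(4 :: real) ^ m > 8"
    by linarith
  then show ?thesis
  proof cases
    case small
    then have "1 \<le> 48 / (4 :: real) ^ m" by (simp add: field_simps)
    then show ?thesis
      using measure_close_angles_le[OF \<tau>, of n i j] \<tau> by linarith
  next
    case large
    define dx dy where "dx = corner_x n i - corner_x n j" and "dy = corner_y n i - corner_y n j"
    obtain s where s: "2 < s" "s \<le> 3" "\<bar>dx + s * dy\<bar> \<le> 8"
      using large(1) \<tau> unfolding dx_def dy_def by (force elim: close_anglesE)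
    have "\<bar>s * dy\<bar> \<le> 3 * \<bar>dy\<bar>" using s by (auto simp: abs_mult intro: mult_right_mono)
    then have dy: "4 ^ m / 3 \<le> \<bar>dy\<bar>"
      using corner_separation[OF m, folded dx_def dy_def] s(3) large(2) by linarith
    then have "dy \<noteq> 0"
      using zero_less_power[of "4 :: real" m] by linarith
    have "close_angles n \<tau> i j = {\<theta> \<in> slope_arc \<tau>. \<bar>dx + tan \<theta> * dy\<bar> \<le> 8}"
      by (simp add: close_angles_def corner_height_diff dx_def dy_def)
    then have "measure lborel (close_angles n \<tau> i j) \<le> 2 * 8 / \<bar>dy\<bar>"
      using measure_arctan_strip_le[OF \<open>dy \<noteq> 0\<close>, of 8 "2 + \<tau> / 2" "2 + \<tau>" dx]
      by (simp add: slope_arc_def)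
    also have "\<dots> \<le> 2 * 8 / (4 ^ m / 3)"
      using dy \<open>dy \<noteq> 0\<close> by (intro divide_left_mono) auto
    finally show ?thesis by simp
  qed simp
qed

text \<open>At slope 2 the corners are equally spaced in height, and changing the slope by at most \<open>\<tau>\<close>
  moves two corners of a common square of side \<open>4 ^ Suc m\<close> relative to each other by at most
  \<open>\<tau> * 4 ^ Suc m\<close>.\<close>

lemma index_diff_le_of_close_angles:
  assumes ij: "i < 4 ^ n" "j < 4 ^ n" and \<tau>: "0 < \<tau>" and m: "branch_level 4 i j m" "m < n"
    and ne: "close_angles n \<tau> i j \<noteq> {}"
  shows "\<bar>real i - real j\<bar> \<le> (8 + 4 * \<tau> * 4 ^ m) / 3"
proof -
  define dx dy where "dx = corner_x n i - corner_x n j" and "dy = corner_y n i - corner_y n j"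
  obtain s where s: "2 + \<tau> / 2 < s" "s \<le> 2 + \<tau>" "\<bar>dx + s * dy\<bar> \<le> 8"
    using ne unfolding dx_def dy_def by (force elim: close_anglesE)
  have "\<bar>(s - 2) * dy\<bar> \<le> \<tau> * 4 ^ Suc m"
    unfolding abs_mult dy_def using s \<tau>
    by (intro mult_mono abs_corner_y_diff_le_at_branch_level[OF m]) auto
  moreover have "3 * (real i - real j) = dx + 2 * dy"
    using corner_height_diff[of n 2 i j] ij by (simp add: corner_height_2 dx_def dy_def)
  then have "3 * (real i - real j) = (dx + s * dy) - (s - 2) * dy"
    by (simp add: algebra_simps)
  then have "\<bar>3 * (real i - real j)\<bar> \<le> \<bar>dx + s * dy\<bar> + \<bar>(s - 2) * dy\<bar>"
    by (simp only: abs_triangle_ineq4)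
  then have "3 * \<bar>real i - real j\<bar> \<le> \<bar>dx + s * dy\<bar> + \<bar>(s - 2) * dy\<bar>"
    by (simp only: abs_mult abs_numeral)
  ultimately show ?thesis using s(3) by simp
qed

section \<open>Mean energy of the shadows\<close>

definition near_pairs :: "nat \<Rightarrow> real \<Rightarrow> nat \<Rightarrow> (nat \<times> nat) set" where
  "near_pairs n \<tau> m = {(i, j). i < 4 ^ n \<and> j < 4 ^ n \<and> i div 4 ^ m \<noteq> j div 4 ^ m \<and>
    \<bar>real i - real j\<bar> \<le> (8 + 4 * \<tau> * 4 ^ m) / 3}"

lemma card_near_pairs_le:
  assumes "0 \<le> \<tau>" "m \<le> n"
  shows "real (card (near_pairs n \<tau> m)) \<le> 4 ^ n * (256 / 9 * (1 / 4) ^ m + 64 / 9 * \<tau>\<^sup>2 * 4 ^ m)"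
proof -
  define q :: real where "q = 4 ^ m"
  have q: "0 < q" "(1 / 4) ^ m = 1 / q" by (simp_all add: q_def power_one_over)
  have "(4 :: nat) ^ n = 4 ^ (n - m) * 4 ^ m"
    using \<open>m \<le> n\<close> by (simp flip: power_add)
  moreover have "(4 :: real) ^ (n - m) = 4 ^ n / q"
    using \<open>m \<le> n\<close> by (simp add: q_def power_diff)
  ultimately have "real (card (near_pairs n \<tau> m)) \<le> 2 * (4 ^ n / q) * ((8 + 4 * \<tau> * q) / 3)\<^sup>2"
    using card_straddling_pairs_le[of "(8 + 4 * \<tau> * q) / 3" "4 ^ (n - m)" "4 ^ m"] \<open>0 \<le> \<tau>\<close> q
    by (simp add: near_pairs_def q_def)
  also have "\<dots> \<le> 2 * (4 ^ n / q) * ((128 + 32 * \<tau>\<^sup>2 * q\<^sup>2) / 9)"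
  proof (rule mult_left_mono)
    show "((8 + 4 * \<tau> * q) / 3)\<^sup>2 \<le> (128 + 32 * \<tau>\<^sup>2 * q\<^sup>2) / 9"
      using zero_le_power2[of "8 - 4 * \<tau> * q"] by (simp add: power2_eq_square algebra_simps)
  qed (use q in simp)
  also have "\<dots> = 4 ^ n * (256 / 9 * (1 / 4) ^ m + 64 / 9 * \<tau>\<^sup>2 * 4 ^ m)"
    using q by (simp add: q_def[symmetric] field_simps power2_eq_square)
  finally show ?thesis .
qed

lemma measure_close_angles_le_sum_near_pairs:
  assumes \<tau>: "0 < \<tau>" "\<tau> \<le> 1" and ij: "i < 4 ^ n" "j < 4 ^ n"
  shows "measure lborel (close_angles n \<tau> i j) \<le> (if i = j then \<tau> / 2 else 0) +
    (\<Sum>m<n. min (\<tau> / 2) (48 / 4 ^ m) * indicator (near_pairs n \<tau> m) (i, j))"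
proof (cases "i = j \<or> close_angles n \<tau> i j = {}")
  case True
  have "0 \<le> (\<Sum>m<n. min (\<tau> / 2) (48 / 4 ^ m) * indicator (near_pairs n \<tau> m) (i, j))"
    using \<tau> by (intro sum_nonneg mult_nonneg_nonneg) auto
  then show ?thesis
    using True measure_close_angles_le[OF \<tau>, of n i j] \<tau> by auto
next
  case False
  then obtain m where m: "m < n" "branch_level 4 i j m"
    using ij by (metis branch_levelE)
  then have "(i, j) \<in> near_pairs n \<tau> m"
    using index_diff_le_of_close_angles[OF ij \<tau>(1) m(2,1)] False ij
    by (simp add: near_pairs_def branch_level_def)
  then have "measure lborel (close_angles n \<tau> i j)
      \<le> min (\<tau> / 2) (48 / 4 ^ m) * indicator (near_pairs n \<tau> m) (i, j)"
    using measure_close_angles_le[OF \<tau>] measure_close_angles_le_at_branch_level[OF \<tau> m(2,1)] by simp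
  also have "\<dots> \<le> (\<Sum>m<n. min (\<tau> / 2) (48 / 4 ^ m) * indicator (near_pairs n \<tau> m) (i, j))"
    using m \<tau> by (intro member_le_sum[of m]) auto
  finally show ?thesis using False by simp
qed

text \<open>The bound \<open>\<tau> / 2\<close> makes the first part of the count of near pairs summable over the levels, the
  bound \<open>48 / 4 ^ m\<close> makes the second part independent of the level.\<close>

lemma near_pairs_energy_le:
  assumes "0 \<le> \<tau>" "m \<le> n"
  shows "min (\<tau> / 2) (48 / 4 ^ m) * real (card (near_pairs n \<tau> m))
    \<le> 4 ^ n * (15 * \<tau> * (1 / 4) ^ m + 342 * \<tau>\<^sup>2)"
proof -
  define b where "b = min (\<tau> / 2) (48 / 4 ^ m)"
  have b: "0 \<le> b" "b \<le> \<tau> / 2" "b * 4 ^ m \<le> 48"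
    using \<open>0 \<le> \<tau>\<close> by (auto simp: b_def min_def field_simps)
  have "b * real (card (near_pairs n \<tau> m))
      \<le> b * (4 ^ n * (256 / 9 * (1 / 4) ^ m + 64 / 9 * \<tau>\<^sup>2 * 4 ^ m))"
    using assms b by (intro mult_left_mono card_near_pairs_le)
  also have "\<dots> = 4 ^ n * (256 / 9 * b * (1 / 4) ^ m + 64 / 9 * \<tau>\<^sup>2 * (b * 4 ^ m))"
    by (simp add: algebra_simps)
  also have "\<dots> \<le> 4 ^ n * (256 / 9 * (\<tau> / 2) * (1 / 4) ^ m + 64 / 9 * \<tau>\<^sup>2 * 48)"
    using b by (intro mult_left_mono add_mono mult_right_mono) auto
  also have "\<dots> \<le> 4 ^ n * (15 * \<tau> * (1 / 4) ^ m + 342 * \<tau>\<^sup>2)"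
    using \<open>0 \<le> \<tau>\<close> by (intro mult_left_mono add_mono mult_right_mono) auto
  finally show ?thesis by (simp add: b_def)
qed

lemma sum_indicator_near_pairs:
  "(\<Sum>p\<in>{..<4 ^ n} \<times> {..<4 ^ n}. indicator (near_pairs n \<tau> m) p) = real (card (near_pairs n \<tau> m))"
proof -
  have "({..<4 ^ n} \<times> {..<4 ^ n}) \<inter> near_pairs n \<tau> m = near_pairs n \<tau> m"
    by (auto simp: near_pairs_def)
  then show ?thesis by (simp add: indicator_def)
qed

lemma sum_measure_close_angles_le_near_pairs:
  assumes \<tau>: "0 < \<tau>" "\<tau> \<le> 1"
  shows "(\<Sum>(i, j)\<in>{..<4 ^ n} \<times> {..<4 ^ n}. measure lborel (close_angles n \<tau> i j))
    \<le> 4 ^ n * (\<tau> / 2) + (\<Sum>m<n. min (\<tau> / 2) (48 / 4 ^ m) * real (card (near_pairs n \<tau> m)))"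
proof -
  let ?P = "{..<(4 :: nat) ^ n} \<times> {..<(4 :: nat) ^ n}"
  let ?b = "\<lambda>m. min (\<tau> / 2) (48 / 4 ^ m)"
  have "(\<Sum>(i, j)\<in>?P. measure lborel (close_angles n \<tau> i j)) \<le>
      (\<Sum>(i, j)\<in>?P. (if i = j then \<tau> / 2 else 0) + (\<Sum>m<n. ?b m * indicator (near_pairs n \<tau> m) (i, j)))"
    using measure_close_angles_le_sum_near_pairs[OF \<tau>]
    by (intro sum_mono) (simp only: split_paired_all prod.case mem_Sigma_iff lessThan_iff)
  also have "\<dots> = (\<Sum>(i, j)\<in>?P. if i = j then \<tau> / 2 else 0) +
      (\<Sum>p\<in>?P. \<Sum>m<n. ?b m * indicator (near_pairs n \<tau> m) p)"
    by (simp add: split_def sum.distrib)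
  also have "(\<Sum>(i, j)\<in>?P. if i = j then \<tau> / 2 else 0) = 4 ^ n * (\<tau> / 2)"
    by (simp flip: sum.cartesian_product)
  also have "(\<Sum>p\<in>?P. \<Sum>m<n. ?b m * indicator (near_pairs n \<tau> m) p)
      = (\<Sum>m<n. ?b m * real (card (near_pairs n \<tau> m)))"
    by (subst sum.swap) (simp only: sum_indicator_near_pairs flip: sum_distrib_left)
  finally show ?thesis .
qed

lemma sum_measure_close_angles_le:
  assumes \<tau>: "0 < \<tau>" "\<tau> \<le> 1" "1 \<le> real n * \<tau>"
  shows "(\<Sum>(i, j)\<in>{..<4 ^ n} \<times> {..<4 ^ n}. measure lborel (close_angles n \<tau> i j))
    \<le> 400 * real n * \<tau>\<^sup>2 * 4 ^ n"
proof -
  have "(\<Sum>m<n. min (\<tau> / 2) (48 / 4 ^ m) * real (card (near_pairs n \<tau> m)))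
      \<le> (\<Sum>m<n. 4 ^ n * (15 * \<tau> * (1 / 4) ^ m + 342 * \<tau>\<^sup>2))"
    using \<tau> by (intro sum_mono near_pairs_energy_le) auto
  also have "\<dots> = 4 ^ n * (15 * \<tau> * (\<Sum>m<n. (1 / 4) ^ m) + real n * (342 * \<tau>\<^sup>2))"
    by (simp add: sum.distrib flip: sum_distrib_left)
  also have "\<dots> \<le> 4 ^ n * (15 * \<tau> * (4 / 3) + real n * (342 * \<tau>\<^sup>2))"
  proof -
    have "(\<Sum>m<n. (1 / 4 :: real) ^ m) \<le> 4 / 3"
      by (subst sum_gp_strict) (simp add: field_simps)
    then show ?thesis using \<tau> by (intro mult_left_mono add_right_mono) auto
  qed
  finally have "(\<Sum>(i, j)\<in>{..<4 ^ n} \<times> {..<4 ^ n}. measure lborel (close_angles n \<tau> i j)) \<le>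
      4 ^ n * (\<tau> / 2 + (20 * \<tau> + real n * (342 * \<tau>\<^sup>2)))"
    using sum_measure_close_angles_le_near_pairs[OF \<tau>(1,2), of n] by (simp add: algebra_simps)
  also have "\<dots> \<le> 4 ^ n * (400 * real n * \<tau>\<^sup>2)"
  proof (rule mult_left_mono)
    have "\<tau> \<le> real n * \<tau>\<^sup>2"
      using mult_right_mono[OF \<tau>(3), of \<tau>] \<tau>(1) by (simp add: power2_eq_square)
    then show "\<tau> / 2 + (20 * \<tau> + real n * (342 * \<tau>\<^sup>2)) \<le> 400 * real n * \<tau>\<^sup>2"
      using \<tau>(1) by linarith
  qed simp
  finally show ?thesis by (simp only: mult.commute)
qed

section \<open>The lower bound\<close>

lemma nn_integral_line_measure_slope_arc_ge:
  fixes S :: "real \<Rightarrow> complex \<Rightarrow> complex"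
  assumes lip: "\<And>\<theta>. \<exists>L \<le> (1 / 4) ^ n. L-lipschitz_on UNIV (\<lambda>z. S \<theta> z - z)"
    and \<tau>: "0 < \<tau>" "\<tau> \<le> 1" "1 \<le> real n * \<tau>"
  shows "ennreal (1 / (320000 * real n))
    \<le> (\<integral>\<^sup>+ \<theta> \<in> slope_arc \<tau>. line_measure \<theta> (Proj \<theta> ` S \<theta> ` cantor_square n) \<partial>lborel)"
proof -
  define c where "c = 1 / (8000 * real n * \<tau>)"
    \<comment> \<open>maximises \<open>c * (\<tau> / 20) - 200 * c\<^sup>2 * n * \<tau>\<^sup>2\<close>\<close>
  let ?P = "{..<(4 :: nat) ^ n} \<times> {..<(4 :: nat) ^ n}"
  let ?E = "\<lambda>p. close_angles n \<tau> (fst p) (snd p)"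
  have n: "0 < real n" using \<tau> by (cases n) auto
  have "c * (\<tau> / 20) - c\<^sup>2 / (2 * 4 ^ n) * (400 * real n * \<tau>\<^sup>2 * 4 ^ n)
      \<le> c * measure lborel (slope_arc \<tau>) - c\<^sup>2 / (2 * 4 ^ n) * (\<Sum>p\<in>?P. measure lborel (?E p))"
    using measure_slope_arc_bounds(1)[OF \<tau>(1,2)] sum_measure_close_angles_le[OF \<tau>] \<tau> n
    by (intro diff_mono mult_left_mono) (auto simp: c_def split_def)
  moreover have "c * (\<tau> / 20) - c\<^sup>2 / (2 * 4 ^ n) * (400 * real n * \<tau>\<^sup>2 * 4 ^ n)
      = 1 / (320000 * real n)"
    using n \<tau> by (simp add: c_def field_simps power2_eq_square)
  ultimately have "ennreal (1 / (320000 * real n))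
      \<le> ennreal (c * measure lborel (slope_arc \<tau>) - c\<^sup>2 / (2 * 4 ^ n) * (\<Sum>p\<in>?P. measure lborel (?E p)))"
    by (intro ennreal_leI) simp
  also have "\<dots> \<le> (\<integral>\<^sup>+ \<theta> \<in> slope_arc \<tau>. line_measure \<theta> (Proj \<theta> ` S \<theta> ` cantor_square n) \<partial>lborel)"
  proof (intro nn_integral_ge_of_card_bound fmeasurable_slope_arc close_angles_subset_slope_arc)
    fix \<theta> assume \<theta>: "\<theta> \<in> slope_arc \<tau>"
    then obtain s where s: "\<theta> = arctan s" "2 \<le> s" "s \<le> 3"
      using \<tau> by (force elim: slope_arcE)
    obtain L where "L \<le> (1 / 4) ^ n" "L-lipschitz_on UNIV (\<lambda>z. S \<theta> z - z)"
      using lip by blast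
    moreover have "{p \<in> ?P. \<theta> \<in> ?E p} = close_pairs n s"
      using \<theta> by (auto simp: s close_angles_def close_pairs_def tan_arctan)
    ultimately show "ennreal (c - c\<^sup>2 / (2 * 4 ^ n) * real (card {p \<in> ?P. \<theta> \<in> ?E p}))
        \<le> line_measure \<theta> (Proj \<theta> ` S \<theta> ` cantor_square n)"
      using line_measure_perturbed_cantor_square_ge[of n s] s n by simp
  qed simp_all
  finally show ?thesis .
qed

lemma disjoint_family_Ioc_antimono:
  fixes u :: "nat \<Rightarrow> 'a::linorder"
  assumes "antimono u"
  shows "disjoint_family (\<lambda>k. {u (Suc k)<..u k})"
proof -
  have "{u (Suc k)<..u k} \<inter> {u (Suc l)<..u l} = {}" if "k < l" for k l
    using antimonoD[OF assms Suc_leI[OF that]] by auto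
  then show ?thesis
    unfolding disjoint_family_on_def by (metis Int_commute linorder_neqE_nat)
qed

lemma disjoint_slope_arcs: "disjoint_family (\<lambda>k. slope_arc ((1 / 2) ^ k))"
proof -
  have "antimono (\<lambda>k. arctan (2 + (1 / 2) ^ k))"
    by (intro antimonoI) (simp add: arctan_le_iff power_decreasing)
  from disjoint_family_Ioc_antimono[OF this] show ?thesis
    by (simp add: slope_arc_def)
qed

lemma slope_arc_subset:
  assumes "0 \<le> \<tau>"
  shows "slope_arc \<tau> \<subseteq> {0..2 * pi}"
proof
  fix \<theta> assume "\<theta> \<in> slope_arc \<tau>"
  then obtain s where "\<theta> = arctan s" "0 < s"
    using assms by (force elim: slope_arcE)
  then have "0 < \<theta>" "\<theta> < pi / 2"
    using arctan_ubound[of s] by simp_all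
  then show "\<theta> \<in> {0..2 * pi}" by simp
qed

lemma dyadic_scalesE:
  assumes "1 \<le> n"
  obtains K :: nat where "ln (real n) \<le> real K" "\<And>k. k < K \<Longrightarrow> 1 \<le> real n * (1 / 2) ^ k"
proof -
  obtain K where K: "2 ^ K \<le> n" "n < 2 ^ (K + 1)"
    using ex_power_ivl1[of 2 n] assms by auto
  show ?thesis
  proof
    have "real n < real (2 ^ Suc K)" using K(2) by (simp only: of_nat_less_iff Suc_eq_plus1)
    then have "ln (real n) \<le> ln (2 ^ Suc K)" using assms by simp
    also have "\<dots> = real (Suc K) * ln 2" by (rule ln_realpow)
    also have "\<dots> \<le> real (Suc K) * 1" using ln_2_less_1 by (intro mult_left_mono) auto
    finally show "ln (real n) \<le> real (Suc K)" by simp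
  next
    fix k assume "k < Suc K"
    then have "(2 :: nat) ^ k \<le> 2 ^ K" by (intro power_increasing) auto
    also note K(1)
    finally have "2 ^ k \<le> n" .
    then have "real (2 ^ k) \<le> real n" by (simp only: of_nat_le_iff)
    then show "1 \<le> real n * (1 / 2) ^ k" by (simp add: power_one_over)
  qed
qed

theorem theorem3:
  fixes T :: "nat \<Rightarrow> complex \<Rightarrow> complex \<Rightarrow> complex"
  assumes lip: "\<And>n \<theta>. n \<ge> 1 \<Longrightarrow>
      \<exists>L < (1/4) ^ n. L-lipschitz_on UNIV (\<lambda>z. T n z (cis \<theta>) - z)"
  shows "\<exists>C > 0. \<forall>n \<ge> 2. Fav (T n) (cantor_square n) \<ge> ennreal (C * ln (real n) / real n)"
proof (intro exI[of _ "1 / (640000 * pi)"] conjI allI impI)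
  fix n :: nat assume "n \<ge> 2"
  then have n: "1 \<le> n" by simp
  let ?F = "\<lambda>\<theta>. line_measure \<theta> (Proj \<theta> ` (\<lambda>z. T n z (cis \<theta>)) ` cantor_square n)"
  obtain K where K: "ln (real n) \<le> real K" "\<And>k. k < K \<Longrightarrow> 1 \<le> real n * (1 / 2) ^ k"
    by (rule dyadic_scalesE[OF n]) blast
  have lip_le: "\<exists>L \<le> (1 / 4) ^ n. L-lipschitz_on UNIV (\<lambda>z. T n z (cis \<theta>) - z)" for \<theta>
    using lip[OF n] less_imp_le by blast
  have "ennreal (ln (real n) / (320000 * real n)) \<le> ennreal (\<Sum>k<K. 1 / (320000 * real n))"
    using K(1) by (intro ennreal_leI) (simp add: divide_right_mono)
  also have "\<dots> = (\<Sum>k<K. ennreal (1 / (320000 * real n)))"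
    by (rule sum_ennreal[symmetric]) simp
  also have "\<dots> \<le> (\<Sum>k<K. \<integral>\<^sup>+ \<theta> \<in> slope_arc ((1 / 2) ^ k). ?F \<theta> \<partial>lborel)"
    using K(2) by (intro sum_mono nn_integral_line_measure_slope_arc_ge lip_le)
      (auto simp: power_le_one)
  also have "\<dots> \<le> (\<integral>\<^sup>+ \<theta> \<in> {0..2 * pi}. ?F \<theta> \<partial>lborel)"
    using disjoint_slope_arcs
    by (intro sum_nn_integral_disjoint_le slope_arc_subset) (auto intro: disjoint_family_on_mono)
  finally have "ennreal (ln (real n) / (320000 * real n)) / ennreal (2 * pi) \<le> Fav (T n) (cantor_square n)"
    unfolding Fav_def by (rule divide_right_mono_ennreal)
  then show "ennreal (1 / (640000 * pi) * ln (real n) / real n) \<le> Fav (T n) (cantor_square n)"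
    using n by (simp add: divide_ennreal field_simps)
qed simp

end
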